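(* Let $(G,m,u,\iota)$ be a group object in a Cartesian tangent category $(\mathbb X,T,p,0,+,\ell,c)$ such that the pullback $T(G)_u$ of $p_G:T(G)\to G$ along $u:1\to G$ exists, with projection $p_u^*:T(G)_u\to T(G)$. Then $T(G)\cong G\times T(G)_u$. The isomorphism is given by $$\phi=\langle p,\langle !,\langle p\iota 0,1\rangle T(m)\rangle\rangle:T(G)\to G\times T(G)_u$$ and its inverse is $$\phi^{-1}=(0\times p_u^* )T(m):G\times T(G)_u\to T(G).$$
   Context: Composition is written in diagrammatic order: $fg$ means first $f$, then $g$. Tangent category $(\mathbb X,T,p,0,+,\ell,c)$: a category $\mathbb X$ with a functor $T:\mathbb X\to\mathbb X$ and a natural transformation $p:T\to 1$ such that the pullback powers $T_n(M)$ of $p_M$ ($n$-fold fibre products of $T(M)$ over $M$) exist for all objects $M$ and are preserved by $T$; natural transformations $+:T_2\to T$, $0:1\to T$ making each $p_M$ an additive bundle (a commutative monoid over $M$: $+p=\pi_0p=\pi_1p$, $0p=1$, $+$ associative, commutative, with unit $0$); a natural transformation $\ell:T\to T^2$ such that $(\ell_M,0_M):(p_M,+_M,0_M)\to(T(p_M),T(+_M),T(0_M))$ is an additive bundle morphism (commutes with projections, additions and zeros); a natural transformation $c:T^2\to T^2$ with $c^2=1$, $\ell c=\ell$ such that $(c_M,1):(T(p_M),T(+_M),T(0_M))\to(p_{TM},+_{TM},0_{TM})$ is an additive bundle morphism; such that $\ell T(\ell)=\ell\,\ell_T$, $T(c)\,c_T\,T(c)=c_T\,T(c)\,c_T$, $\ell_T\,T(c)\,c_T=c\,T(\ell)$,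 and $\langle\pi_0\ell,\pi_1 0_T\rangle T(+):T_2M\to T^2M$ is the equalizer of $T(p)$ and $T(p)p0:T^2M\to TM$. Cartesian tangent category: a tangent category with all finite products (terminal object $1$) such that the product functor, with the natural isomorphism $T(A)\times T(B)\cong T(A\times B)$, is a strong morphism of tangent categories (the canonical comparison maps are isomorphisms compatible with $p,0,+,\ell,c$; in particular $0_1:1\to T(1)$ is an isomorphism). These identifications are suppressed, so e.g. $T(m):T(G)\times T(G)\to T(G)$. A group object has multiplication $m:G\times G\to G$, unit $u:1\to G$, inversion $\iota:G\to G$. $!$ denotes the unique map to $1$; $f\times g=\langle\pi_0f,\pi_1g\rangle$. For $h:X\to T(G)$ with $hp=!u$, $\langle !,h\rangle:X\to T(G)_u$ is the unique map with $\langle !,h\rangle p_u^*=h$. *)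

theory Defs
  imports Main
begin

section \<open>Categories\<close>

text \<open>Composition is diagrammatic: \<open>f \<cdot> g\<close> is first \<open>f\<close>, then \<open>g\<close>.\<close>

record ('o, 'a) category =
  Obj :: "'o set"
  Arr :: "'a set"
  Dom :: "'a \<Rightarrow> 'o"
  Cod :: "'a \<Rightarrow> 'o"
  Ident :: "'o \<Rightarrow> 'a"
  Comp :: "'a \<Rightarrow> 'a \<Rightarrow> 'a" (infixl "\<cdot>\<index>" 70)

definition hom :: "('o, 'a, 'z) category_scheme \<Rightarrow> 'o \<Rightarrow> 'o \<Rightarrow> 'a set" where
  "hom C A B = {f \<in> Arr C. Dom C f = A \<and> Cod C f = B}"

locale category =
  fixes C :: "('o, 'a, 'z) category_scheme" (structure)
  assumes Dom_Obj: "f \<in> Arr C \<Longrightarrow> Dom C f \<in> Obj C"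
    and Cod_Obj: "f \<in> Arr C \<Longrightarrow> Cod C f \<in> Obj C"
    and Ident_hom: "A \<in> Obj C \<Longrightarrow> Ident C A \<in> hom C A A"
    and Comp_hom: "f \<in> hom C A B \<Longrightarrow> g \<in> hom C B D \<Longrightarrow> f \<cdot> g \<in> hom C A D"
    and Ident_Comp: "f \<in> hom C A B \<Longrightarrow> Ident C A \<cdot> f = f"
    and Comp_Ident: "f \<in> hom C A B \<Longrightarrow> f \<cdot> Ident C B = f"
    and Comp_assoc: "f \<in> hom C A B \<Longrightarrow> g \<in> hom C B D \<Longrightarrow> h \<in> hom C D E \<Longrightarrow>
      (f \<cdot> g) \<cdot> h = f \<cdot> (g \<cdot> h)"

definition inverse_arrows ::
  "('o, 'a, 'z) category_scheme \<Rightarrow> 'o \<Rightarrow> 'o \<Rightarrow> 'a \<Rightarrow> 'a \<Rightarrow> bool" where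
  "inverse_arrows C A B f g \<longleftrightarrow> f \<in> hom C A B \<and> g \<in> hom C B A \<and>
     f \<cdot>\<^bsub>C\<^esub> g = Ident C A \<and> g \<cdot>\<^bsub>C\<^esub> f = Ident C B"

definition iso_arrow :: "('o, 'a, 'z) category_scheme \<Rightarrow> 'o \<Rightarrow> 'o \<Rightarrow> 'a \<Rightarrow> bool" where
  "iso_arrow C A B f \<longleftrightarrow> (\<exists>g. inverse_arrows C A B f g)"

definition inverse_arrow :: "('o, 'a, 'z) category_scheme \<Rightarrow> 'a \<Rightarrow> 'a" where
  "inverse_arrow C f = (THE g. inverse_arrows C (Dom C f) (Cod C f) f g)"

definition isomorphic :: "('o, 'a, 'z) category_scheme \<Rightarrow> 'o \<Rightarrow> 'o \<Rightarrow> bool" where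
  "isomorphic C A B \<longleftrightarrow> (\<exists>f. iso_arrow C A B f)"


section \<open>Limits\<close>

text \<open>The arrow \<open>\<langle>f, g\<rangle>\<close> into a (fibre) product \<open>P\<close> with projections \<open>\<pi>0\<close>, \<open>\<pi>1\<close>.\<close>

definition induced ::
  "('o, 'a, 'z) category_scheme \<Rightarrow> 'o \<Rightarrow> 'a \<Rightarrow> 'a \<Rightarrow> 'a \<Rightarrow> 'a \<Rightarrow> 'a" where
  "induced C P \<pi>0 \<pi>1 f g =
     (THE h. h \<in> hom C (Dom C f) P \<and> h \<cdot>\<^bsub>C\<^esub> \<pi>0 = f \<and> h \<cdot>\<^bsub>C\<^esub> \<pi>1 = g)"

text \<open>\<open>P\<close> with \<open>\<pi>0 : P \<rightarrow> A\<close>, \<open>\<pi>1 : P \<rightarrow> B\<close> is a pullback of \<open>f : A \<rightarrow> Z\<close> and \<open>g : B \<rightarrow> Z\<close>.\<close>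

definition is_pullback ::
  "('o, 'a, 'z) category_scheme \<Rightarrow> 'o \<Rightarrow> 'o \<Rightarrow> 'o \<Rightarrow> 'a \<Rightarrow> 'a \<Rightarrow> 'o \<Rightarrow> 'a \<Rightarrow> 'a \<Rightarrow> bool" where
  "is_pullback C A B Z f g P \<pi>0 \<pi>1 \<longleftrightarrow>
     f \<in> hom C A Z \<and> g \<in> hom C B Z \<and>
     P \<in> Obj C \<and> \<pi>0 \<in> hom C P A \<and> \<pi>1 \<in> hom C P B \<and> \<pi>0 \<cdot>\<^bsub>C\<^esub> f = \<pi>1 \<cdot>\<^bsub>C\<^esub> g \<and>
     (\<forall>X \<in> Obj C. \<forall>a \<in> hom C X A. \<forall>b \<in> hom C X B. a \<cdot>\<^bsub>C\<^esub> f = b \<cdot>\<^bsub>C\<^esub> g \<longrightarrow>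
        (\<exists>!h. h \<in> hom C X P \<and> h \<cdot>\<^bsub>C\<^esub> \<pi>0 = a \<and> h \<cdot>\<^bsub>C\<^esub> \<pi>1 = b))"

text \<open>\<open>P\<close> is an \<open>n\<close>-fold fibre product of \<open>q : E \<rightarrow> M\<close> over \<open>M\<close>, with structure map
  \<open>r : P \<rightarrow> M\<close> and projections \<open>\<pi> 0, \<dots>, \<pi> (n - 1) : P \<rightarrow> E\<close>.  The map \<open>r\<close> matters only for
  \<open>n = 0\<close>, where it makes \<open>P\<close> isomorphic to \<open>M\<close>.\<close>

definition is_fibre_power ::
  "('o, 'a, 'z) category_scheme \<Rightarrow> 'o \<Rightarrow> 'o \<Rightarrow> 'a \<Rightarrow> nat \<Rightarrow> 'o \<Rightarrow> 'a \<Rightarrow> (nat \<Rightarrow> 'a) \<Rightarrow> bool" where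
  "is_fibre_power C E M q n P r \<pi> \<longleftrightarrow>
     q \<in> hom C E M \<and> P \<in> Obj C \<and> r \<in> hom C P M \<and>
     (\<forall>i<n. \<pi> i \<in> hom C P E \<and> \<pi> i \<cdot>\<^bsub>C\<^esub> q = r) \<and>
     (\<forall>X \<in> Obj C. \<forall>s \<in> hom C X M. \<forall>f. (\<forall>i<n. f i \<in> hom C X E \<and> f i \<cdot>\<^bsub>C\<^esub> q = s) \<longrightarrow>
        (\<exists>!h. h \<in> hom C X P \<and> h \<cdot>\<^bsub>C\<^esub> r = s \<and> (\<forall>i<n. h \<cdot>\<^bsub>C\<^esub> \<pi> i = f i)))"

text \<open>\<open>e : X \<rightarrow> A\<close> is an equalizer of \<open>f, g : A \<rightarrow> B\<close>.\<close>

definition is_equalizer ::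
  "('o, 'a, 'z) category_scheme \<Rightarrow> 'o \<Rightarrow> 'o \<Rightarrow> 'o \<Rightarrow> 'a \<Rightarrow> 'a \<Rightarrow> 'a \<Rightarrow> bool" where
  "is_equalizer C X A B e f g \<longleftrightarrow>
     f \<in> hom C A B \<and> g \<in> hom C A B \<and> e \<in> hom C X A \<and> e \<cdot>\<^bsub>C\<^esub> f = e \<cdot>\<^bsub>C\<^esub> g \<and>
     (\<forall>Y \<in> Obj C. \<forall>k \<in> hom C Y A. k \<cdot>\<^bsub>C\<^esub> f = k \<cdot>\<^bsub>C\<^esub> g \<longrightarrow>
        (\<exists>!h. h \<in> hom C Y X \<and> h \<cdot>\<^bsub>C\<^esub> e = k))"


section \<open>Finite products and group objects\<close>

record ('o, 'a) product_structure =
  Term :: 'o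
  Prod :: "'o \<Rightarrow> 'o \<Rightarrow> 'o"
  Pr0 :: "'o \<Rightarrow> 'o \<Rightarrow> 'a"
  Pr1 :: "'o \<Rightarrow> 'o \<Rightarrow> 'a"

definition bang :: "('o, 'a, 'z) category_scheme \<Rightarrow> ('o, 'a, 'y) product_structure_scheme \<Rightarrow> 'o \<Rightarrow> 'a" where
  "bang C P X = (THE f. f \<in> hom C X (Term P))"

definition pair ::
  "('o, 'a, 'z) category_scheme \<Rightarrow> ('o, 'a, 'y) product_structure_scheme \<Rightarrow> 'a \<Rightarrow> 'a \<Rightarrow> 'a" where
  "pair C P f g = induced C (Prod P (Cod C f) (Cod C g))
     (Pr0 P (Cod C f) (Cod C g)) (Pr1 P (Cod C f) (Cod C g)) f g"

definition cross ::
  "('o, 'a, 'z) category_scheme \<Rightarrow> ('o, 'a, 'y) product_structure_scheme \<Rightarrow> 'a \<Rightarrow> 'a \<Rightarrow> 'a" where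
  "cross C P f g = pair C P (Pr0 P (Dom C f) (Dom C g) \<cdot>\<^bsub>C\<^esub> f) (Pr1 P (Dom C f) (Dom C g) \<cdot>\<^bsub>C\<^esub> g)"

locale cartesian_category = category C
  for C :: "('o, 'a, 'z) category_scheme" (structure) +
  fixes P :: "('o, 'a, 'y) product_structure_scheme"
  assumes Term_Obj: "Term P \<in> Obj C"
    and Term_univ: "X \<in> Obj C \<Longrightarrow> \<exists>!f. f \<in> hom C X (Term P)"
    and Prod_Obj: "A \<in> Obj C \<Longrightarrow> B \<in> Obj C \<Longrightarrow> Prod P A B \<in> Obj C"
    and Pr0_hom: "A \<in> Obj C \<Longrightarrow> B \<in> Obj C \<Longrightarrow> Pr0 P A B \<in> hom C (Prod P A B) A"
    and Pr1_hom: "A \<in> Obj C \<Longrightarrow> B \<in> Obj C \<Longrightarrow> Pr1 P A B \<in> hom C (Prod P A B) B"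
    and Prod_univ: "f \<in> hom C X A \<Longrightarrow> g \<in> hom C X B \<Longrightarrow>
      \<exists>!h. h \<in> hom C X (Prod P A B) \<and> h \<cdot> Pr0 P A B = f \<and> h \<cdot> Pr1 P A B = g"

text \<open>In the associativity law both sides are arrows \<open>(G \<times> G) \<times> G \<rightarrow> G\<close>; the second one is
  preceded by the associator \<open>\<langle>\<pi>0 \<pi>0, \<langle>\<pi>0 \<pi>1, \<pi>1\<rangle>\<rangle>\<close>.\<close>

locale group_object = cartesian_category C P
  for C :: "('o, 'a, 'z) category_scheme" (structure)
    and P :: "('o, 'a, 'y) product_structure_scheme" +
  fixes G :: 'o and m u \<iota> :: 'a
  assumes G_Obj: "G \<in> Obj C"
    and m_hom: "m \<in> hom C (Prod P G G) G"
    and u_hom: "u \<in> hom C (Term P) G"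
    and inv_hom: "\<iota> \<in> hom C G G"
    and m_assoc: "cross C P m (Ident C G) \<cdot> m =
      pair C P (Pr0 P (Prod P G G) G \<cdot> Pr0 P G G)
        (pair C P (Pr0 P (Prod P G G) G \<cdot> Pr1 P G G) (Pr1 P (Prod P G G) G)) \<cdot>
      cross C P (Ident C G) m \<cdot> m"
    and m_left_unit: "pair C P (bang C P G \<cdot> u) (Ident C G) \<cdot> m = Ident C G"
    and m_right_unit: "pair C P (Ident C G) (bang C P G \<cdot> u) \<cdot> m = Ident C G"
    and m_left_inv: "pair C P \<iota> (Ident C G) \<cdot> m = bang C P G \<cdot> u"
    and m_right_inv: "pair C P (Ident C G) \<iota> \<cdot> m = bang C P G \<cdot> u"


section \<open>Endofunctors and natural transformations\<close>

record ('o, 'a) endofunctor =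
  ob :: "'o \<Rightarrow> 'o"
  ar :: "'a \<Rightarrow> 'a"

definition is_endofunctor ::
  "('o, 'a, 'z) category_scheme \<Rightarrow> ('o, 'a, 'y) endofunctor_scheme \<Rightarrow> bool" where
  "is_endofunctor C F \<longleftrightarrow>
     (\<forall>A \<in> Obj C. ob F A \<in> Obj C \<and> ar F (Ident C A) = Ident C (ob F A)) \<and>
     (\<forall>A B. \<forall>f \<in> hom C A B. ar F f \<in> hom C (ob F A) (ob F B)) \<and>
     (\<forall>A B D. \<forall>f \<in> hom C A B. \<forall>g \<in> hom C B D. ar F (f \<cdot>\<^bsub>C\<^esub> g) = ar F f \<cdot>\<^bsub>C\<^esub> ar F g)"

definition id_functor :: "('o, 'a) endofunctor" where
  "id_functor = \<lparr>ob = (\<lambda>A. A), ar = (\<lambda>f. f)\<rparr>"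

definition square_functor :: "('o, 'a, 'y) endofunctor_scheme \<Rightarrow> ('o, 'a) endofunctor" where
  "square_functor F = \<lparr>ob = (\<lambda>A. ob F (ob F A)), ar = (\<lambda>f. ar F (ar F f))\<rparr>"

definition is_natural ::
  "('o, 'a, 'z) category_scheme \<Rightarrow> ('o, 'a, 'x) endofunctor_scheme \<Rightarrow>
   ('o, 'a, 'y) endofunctor_scheme \<Rightarrow> ('o \<Rightarrow> 'a) \<Rightarrow> bool" where
  "is_natural C F G \<eta> \<longleftrightarrow>
     (\<forall>A \<in> Obj C. \<eta> A \<in> hom C (ob F A) (ob G A)) \<and>
     (\<forall>A B. \<forall>f \<in> hom C A B. ar F f \<cdot>\<^bsub>C\<^esub> \<eta> B = \<eta> A \<cdot>\<^bsub>C\<^esub> ar G f)"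


section \<open>Additive bundles\<close>

text \<open>\<open>prj : tot \<rightarrow> base\<close>, together with a choice \<open>tot2\<close> of the fibre product of \<open>prj\<close> with itself
  (projections \<open>sq0\<close>, \<open>sq1\<close>), addition \<open>addn : tot2 \<rightarrow> tot\<close> and zero \<open>zer : base \<rightarrow> tot\<close>.\<close>

record ('o, 'a) bundle_data =
  tot :: 'o
  base :: 'o
  prj :: 'a
  tot2 :: 'o
  sq0 :: 'a
  sq1 :: 'a
  addn :: 'a
  zer :: 'a

definition bpair :: "('o, 'a, 'z) category_scheme \<Rightarrow> ('o, 'a) bundle_data \<Rightarrow> 'a \<Rightarrow> 'a \<Rightarrow> 'a" where
  "bpair C B f g = induced C (tot2 B) (sq0 B) (sq1 B) f g"

definition additive_bundle :: "('o, 'a, 'z) category_scheme \<Rightarrow> ('o, 'a) bundle_data \<Rightarrow> bool" where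
  "additive_bundle C B \<longleftrightarrow>
     is_pullback C (tot B) (tot B) (base B) (prj B) (prj B) (tot2 B) (sq0 B) (sq1 B) \<and>
     (\<forall>n. \<exists>P r \<pi>. is_fibre_power C (tot B) (base B) (prj B) n P r \<pi>) \<and>
     addn B \<in> hom C (tot2 B) (tot B) \<and> zer B \<in> hom C (base B) (tot B) \<and>
     addn B \<cdot>\<^bsub>C\<^esub> prj B = sq0 B \<cdot>\<^bsub>C\<^esub> prj B \<and>
     zer B \<cdot>\<^bsub>C\<^esub> prj B = Ident C (base B) \<and>
     (\<forall>P r \<pi>. is_fibre_power C (tot B) (base B) (prj B) 3 P r \<pi> \<longrightarrow>
        bpair C B (bpair C B (\<pi> 0) (\<pi> 1) \<cdot>\<^bsub>C\<^esub> addn B) (\<pi> 2) \<cdot>\<^bsub>C\<^esub> addn B =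
        bpair C B (\<pi> 0) (bpair C B (\<pi> 1) (\<pi> 2) \<cdot>\<^bsub>C\<^esub> addn B) \<cdot>\<^bsub>C\<^esub> addn B) \<and>
     bpair C B (sq1 B) (sq0 B) \<cdot>\<^bsub>C\<^esub> addn B = addn B \<and>
     bpair C B (prj B \<cdot>\<^bsub>C\<^esub> zer B) (Ident C (tot B)) \<cdot>\<^bsub>C\<^esub> addn B = Ident C (tot B)"

definition additive_bundle_morphism ::
  "('o, 'a, 'z) category_scheme \<Rightarrow> ('o, 'a) bundle_data \<Rightarrow> ('o, 'a) bundle_data \<Rightarrow> 'a \<Rightarrow> 'a \<Rightarrow> bool" where
  "additive_bundle_morphism C B B' f g \<longleftrightarrow>
     f \<in> hom C (tot B) (tot B') \<and> g \<in> hom C (base B) (base B') \<and>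
     f \<cdot>\<^bsub>C\<^esub> prj B' = prj B \<cdot>\<^bsub>C\<^esub> g \<and>
     addn B \<cdot>\<^bsub>C\<^esub> f = bpair C B' (sq0 B \<cdot>\<^bsub>C\<^esub> f) (sq1 B \<cdot>\<^bsub>C\<^esub> f) \<cdot>\<^bsub>C\<^esub> addn B' \<and>
     zer B \<cdot>\<^bsub>C\<^esub> f = g \<cdot>\<^bsub>C\<^esub> zer B'"

definition map_bundle :: "('o, 'a, 'y) endofunctor_scheme \<Rightarrow> ('o, 'a) bundle_data \<Rightarrow> ('o, 'a) bundle_data" where
  "map_bundle F B = \<lparr>tot = ob F (tot B), base = ob F (base B), prj = ar F (prj B),
     tot2 = ob F (tot2 B), sq0 = ar F (sq0 B), sq1 = ar F (sq1 B),
     addn = ar F (addn B), zer = ar F (zer B)\<rparr>"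


section \<open>Tangent categories\<close>

text \<open>The endofunctor part is \<open>T\<close>; the remaining fields are \<open>p\<close>, \<open>0\<close>, a choice of \<open>T\<^sub>2\<close> with its
  two projections, \<open>+\<close>, \<open>\<ell>\<close> and \<open>c\<close>.\<close>

record ('o, 'a) tangent_structure = "('o, 'a) endofunctor" +
  tp :: "'o \<Rightarrow> 'a"
  tzero :: "'o \<Rightarrow> 'a"
  tan2 :: "'o \<Rightarrow> 'o"
  tpr0 :: "'o \<Rightarrow> 'a"
  tpr1 :: "'o \<Rightarrow> 'a"
  tplus :: "'o \<Rightarrow> 'a"
  tlift :: "'o \<Rightarrow> 'a"
  tflip :: "'o \<Rightarrow> 'a"

definition tangent_bundle :: "('o, 'a, 'y) tangent_structure_scheme \<Rightarrow> 'o \<Rightarrow> ('o, 'a) bundle_data" where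
  "tangent_bundle T M = \<lparr>tot = ob T M, base = M, prj = tp T M,
     tot2 = tan2 T M, sq0 = tpr0 T M, sq1 = tpr1 T M, addn = tplus T M, zer = tzero T M\<rparr>"

definition tan2_functor ::
  "('o, 'a, 'z) category_scheme \<Rightarrow> ('o, 'a, 'y) tangent_structure_scheme \<Rightarrow> ('o, 'a) endofunctor" where
  "tan2_functor C T = \<lparr>ob = tan2 T,
     ar = (\<lambda>f. bpair C (tangent_bundle T (Cod C f))
        (tpr0 T (Dom C f) \<cdot>\<^bsub>C\<^esub> ar T f) (tpr1 T (Dom C f) \<cdot>\<^bsub>C\<^esub> ar T f))\<rparr>"

locale tangent_category = category C
  for C :: "('o, 'a, 'z) category_scheme" (structure) +
  fixes T :: "('o, 'a, 'y) tangent_structure_scheme"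
  assumes T_functor: "is_endofunctor C T"
    and p_natural: "is_natural C T id_functor (tp T)"
    and zero_natural: "is_natural C id_functor T (tzero T)"
    and plus_natural: "is_natural C (tan2_functor C T) T (tplus T)"
    and lift_natural: "is_natural C T (square_functor T) (tlift T)"
    and flip_natural: "is_natural C (square_functor T) (square_functor T) (tflip T)"
    and tangent_additive: "M \<in> Obj C \<Longrightarrow> additive_bundle C (tangent_bundle T M)"
    and T_preserves: "M \<in> Obj C \<Longrightarrow> is_fibre_power C (ob T M) M (tp T M) n P r \<pi> \<Longrightarrow>
      is_fibre_power C (ob T (ob T M)) (ob T M) (ar T (tp T M)) n (ob T P) (ar T r) (\<lambda>i. ar T (\<pi> i))"
    and lift_additive: "M \<in> Obj C \<Longrightarrow>
      additive_bundle_morphism C (tangent_bundle T M) (map_bundle T (tangent_bundle T M))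
        (tlift T M) (tzero T M)"
    and flip_additive: "M \<in> Obj C \<Longrightarrow>
      additive_bundle_morphism C (map_bundle T (tangent_bundle T M)) (tangent_bundle T (ob T M))
        (tflip T M) (Ident C (ob T M))"
    and flip_flip: "M \<in> Obj C \<Longrightarrow> tflip T M \<cdot> tflip T M = Ident C (ob T (ob T M))"
    and lift_flip: "M \<in> Obj C \<Longrightarrow> tlift T M \<cdot> tflip T M = tlift T M"
    and lift_coassoc: "M \<in> Obj C \<Longrightarrow>
      tlift T M \<cdot> ar T (tlift T M) = tlift T M \<cdot> tlift T (ob T M)"
    and flip_braid: "M \<in> Obj C \<Longrightarrow>
      ar T (tflip T M) \<cdot> tflip T (ob T M) \<cdot> ar T (tflip T M) =
      tflip T (ob T M) \<cdot> ar T (tflip T M) \<cdot> tflip T (ob T M)"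
    and lift_flip_braid: "M \<in> Obj C \<Longrightarrow>
      tlift T (ob T M) \<cdot> ar T (tflip T M) \<cdot> tflip T (ob T M) = tflip T M \<cdot> ar T (tlift T M)"
    and lift_universal: "M \<in> Obj C \<Longrightarrow>
      is_equalizer C (tan2 T M) (ob T (ob T M)) (ob T M)
        (bpair C (map_bundle T (tangent_bundle T M))
           (tpr0 T M \<cdot> tlift T M) (tpr1 T M \<cdot> tzero T (ob T M)) \<cdot> ar T (tplus T M))
        (ar T (tp T M))
        (ar T (tp T M) \<cdot> tp T M \<cdot> tzero T M)"


section \<open>Cartesian tangent categories\<close>

text \<open>\<open>\<langle>F \<pi>0, F \<pi>1\<rangle> : F (A \<times> B) \<rightarrow> F A \<times> F B\<close>\<close>

definition comparison ::
  "('o, 'a, 'z) category_scheme \<Rightarrow> ('o, 'a, 'x) product_structure_scheme \<Rightarrow>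
   ('o, 'a, 'y) endofunctor_scheme \<Rightarrow> 'o \<Rightarrow> 'o \<Rightarrow> 'a" where
  "comparison C P F A B = pair C P (ar F (Pr0 P A B)) (ar F (Pr1 P A B))"

text \<open>The axioms say that the inverses \<open>T A \<times> T B \<rightarrow> T (A \<times> B)\<close> and \<open>1 \<rightarrow> T 1\<close> of the comparison
  maps make the product functor and the terminal object strong morphisms of tangent categories.
  Compatibility with the tangent structure at the terminal object, and preservation of the
  tangent pullbacks and equalizers by the product functor, hold automatically.\<close>

locale cartesian_tangent_category = tangent_category C T + cartesian_category C P
  for C :: "('o, 'a, 'z) category_scheme" (structure)
    and T :: "('o, 'a, 'y) tangent_structure_scheme"
    and P :: "('o, 'a, 'x) product_structure_scheme" +
  assumes comparison_Term: "iso_arrow C (ob T (Term P)) (Term P) (bang C P (ob T (Term P)))"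
    and comparison_Prod: "A \<in> Obj C \<Longrightarrow> B \<in> Obj C \<Longrightarrow>
      iso_arrow C (ob T (Prod P A B)) (Prod P (ob T A) (ob T B)) (comparison C P T A B)"
    and comparison_p: "A \<in> Obj C \<Longrightarrow> B \<in> Obj C \<Longrightarrow>
      comparison C P T A B \<cdot> cross C P (tp T A) (tp T B) = tp T (Prod P A B)"
    and comparison_zero: "A \<in> Obj C \<Longrightarrow> B \<in> Obj C \<Longrightarrow>
      tzero T (Prod P A B) \<cdot> comparison C P T A B = cross C P (tzero T A) (tzero T B)"
    and comparison_plus: "A \<in> Obj C \<Longrightarrow> B \<in> Obj C \<Longrightarrow>
      tplus T (Prod P A B) \<cdot> comparison C P T A B =
      comparison C P (tan2_functor C T) A B \<cdot> cross C P (tplus T A) (tplus T B)"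
    and comparison_lift: "A \<in> Obj C \<Longrightarrow> B \<in> Obj C \<Longrightarrow>
      tlift T (Prod P A B) \<cdot> comparison C P (square_functor T) A B =
      comparison C P T A B \<cdot> cross C P (tlift T A) (tlift T B)"
    and comparison_flip: "A \<in> Obj C \<Longrightarrow> B \<in> Obj C \<Longrightarrow>
      tflip T (Prod P A B) \<cdot> comparison C P (square_functor T) A B =
      comparison C P (square_functor T) A B \<cdot> cross C P (tflip T A) (tflip T B)"

text \<open>The arrow \<open>T m : T G \<times> T G \<rightarrow> T G\<close>, with the identification \<open>T G \<times> T G \<cong> T (G \<times> G)\<close> made explicit.\<close>

definition tangent_mult ::
  "('o, 'a, 'z) category_scheme \<Rightarrow> ('o, 'a, 'y) tangent_structure_scheme \<Rightarrow>
   ('o, 'a, 'x) product_structure_scheme \<Rightarrow> 'o \<Rightarrow> 'a \<Rightarrow> 'a" where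
  "tangent_mult C T P G m = inverse_arrow C (comparison C P T G G) \<cdot>\<^bsub>C\<^esub> ar T m"

end

theory Submission
  imports Defs
begin

text \<open>Work with generalized elements: arrows \<open>X \<rightarrow> G\<close> are multiplied through \<open>m\<close> (written
  \<open>a \<bullet> b\<close>) and arrows \<open>X \<rightarrow> T(G)\<close> through \<open>T(m)\<close> (written \<open>x \<star> y\<close>).  Since \<open>T\<close> preserves the
  products \<open>G \<times> G\<close> and \<open>(G \<times> G) \<times> G\<close> and the terminal object, \<open>\<star>\<close> is again associative, with unit
  the zero vector at \<open>u\<close>; naturality of \<open>0\<close> and \<open>p\<close> makes the zero section and the projection
  multiplicative (\<open>tmul_assoc\<close>, \<open>tmul_left_unit\<close>, \<open>tmul_zero\<close>, \<open>tmul_p\<close>).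

  The theorem is now left translation in the group \<open>T(G)\<close>.  A tangent vector \<open>x\<close> at the point
  \<open>g = x p\<close> is moved to the tangent vector \<open>0(g\<inverse>) \<star> x\<close>, which lies over \<open>g\<inverse> \<bullet> g = u\<close> and so
  belongs to the fibre \<open>T(G)\<^sub>u\<close>; the pair of \<open>g\<close> and this vector determines \<open>x\<close>, because
  \<open>0(g) \<star> (0(g\<inverse>) \<star> x) = 0(g \<bullet> g\<inverse>) \<star> x = x\<close>.  Conversely, for a point \<open>g\<close> and a vector \<open>v\<close> at
  \<open>u\<close>, the vector \<open>0(g) \<star> v\<close> lies over \<open>g \<bullet> u = g\<close>, and translating it back by \<open>0(g\<inverse>)\<close> gives \<open>v\<close>.\<close>


section \<open>Composition and finite products\<close>

text \<open>The axioms of a category are restated with explicit domains and codomains, because in this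
  form the simplifier can discharge the typing conditions; after unfolding \<open>hom_def\<close>, composites are
  rewritten to right-associated form.\<close>

context category
begin

lemma comp_typing [simp]:
  assumes "f \<in> Arr C" "g \<in> Arr C" "Cod C f = Dom C g"
  shows "f \<cdot> g \<in> Arr C" "Dom C (f \<cdot> g) = Dom C f" "Cod C (f \<cdot> g) = Cod C g"
  using Comp_hom[of f "Dom C f" "Cod C f" g "Cod C g"] assms by (auto simp: hom_def)

lemma comp_assoc [simp]:
  assumes "f \<in> Arr C" "g \<in> Arr C" "h \<in> Arr C" "Cod C f = Dom C g" "Cod C g = Dom C h"
  shows "(f \<cdot> g) \<cdot> h = f \<cdot> (g \<cdot> h)"
  using Comp_assoc[of f "Dom C f" "Cod C f" g "Cod C g" h "Cod C h"] assms by (auto simp: hom_def)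

lemma ident_typing [simp]:
  assumes "A \<in> Obj C"
  shows "Ident C A \<in> Arr C" "Dom C (Ident C A) = A" "Cod C (Ident C A) = A"
  using Ident_hom[OF assms] by (auto simp: hom_def)

lemma ident_comp [simp]: "f \<in> Arr C \<Longrightarrow> Dom C f = A \<Longrightarrow> Ident C A \<cdot> f = f"
  using Ident_Comp[of f A "Cod C f"] by (auto simp: hom_def)

lemma comp_ident [simp]: "f \<in> Arr C \<Longrightarrow> Cod C f = A \<Longrightarrow> f \<cdot> Ident C A = f"
  using Comp_Ident[of f "Dom C f" A] by (auto simp: hom_def)

lemma inverse_arrow_inverse:
  assumes "iso_arrow C A B f"
  shows "inverse_arrows C A B f (inverse_arrow C f)"
proof -
  obtain g where g: "inverse_arrows C A B f g"
    using assms by (auto simp: iso_arrow_def)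
  have unique: "g' = g" if "inverse_arrows C A B f g'" for g'
  proof -
    have "g' = g' \<cdot> (f \<cdot> g)" "(g' \<cdot> f) \<cdot> g = g"
      using g that by (auto simp: inverse_arrows_def hom_def Dom_Obj Cod_Obj)
    moreover have "(g' \<cdot> f) \<cdot> g = g' \<cdot> (f \<cdot> g)"
      using g that by (intro comp_assoc) (auto simp: inverse_arrows_def hom_def)
    ultimately show ?thesis
      by simp
  qed
  have "Dom C f = A" "Cod C f = B"
    using g by (auto simp: inverse_arrows_def hom_def)
  then show ?thesis
    unfolding inverse_arrow_def using g unique by (metis theI)
qed

lemma pullback_induced:
  assumes pb: "is_pullback C A B Z f g Q \<pi>0 \<pi>1"
    and ab: "a \<in> hom C X A" "b \<in> hom C X B" "a \<cdot> f = b \<cdot> g"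
  shows "induced C Q \<pi>0 \<pi>1 a b \<in> hom C X Q"
    "induced C Q \<pi>0 \<pi>1 a b \<cdot> \<pi>0 = a" "induced C Q \<pi>0 \<pi>1 a b \<cdot> \<pi>1 = b"
proof -
  have "X \<in> Obj C" "Dom C a = X"
    using ab(1) by (auto simp: hom_def Dom_Obj)
  then have "\<exists>!h. h \<in> hom C (Dom C a) Q \<and> h \<cdot> \<pi>0 = a \<and> h \<cdot> \<pi>1 = b"
    using pb ab unfolding is_pullback_def by blast
  from theI'[OF this] show "induced C Q \<pi>0 \<pi>1 a b \<in> hom C X Q"
    "induced C Q \<pi>0 \<pi>1 a b \<cdot> \<pi>0 = a" "induced C Q \<pi>0 \<pi>1 a b \<cdot> \<pi>1 = b"
    using \<open>Dom C a = X\<close> by (auto simp: induced_def)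
qed

lemma pullback_cancel:
  assumes pb: "is_pullback C A B Z f g Q \<pi>0 \<pi>1"
    and hk: "h \<in> hom C X Q" "k \<in> hom C X Q" "h \<cdot> \<pi>0 = k \<cdot> \<pi>0" "h \<cdot> \<pi>1 = k \<cdot> \<pi>1"
  shows "h = k"
proof -
  have sq: "\<pi>0 \<in> hom C Q A" "\<pi>1 \<in> hom C Q B" "f \<in> hom C A Z" "g \<in> hom C B Z" "\<pi>0 \<cdot> f = \<pi>1 \<cdot> g"
    using pb unfolding is_pullback_def by blast+
  have "(k \<cdot> \<pi>0) \<cdot> f = (k \<cdot> \<pi>1) \<cdot> g"
    using sq hk(2) by (simp add: hom_def)
  moreover have "X \<in> Obj C" "k \<cdot> \<pi>0 \<in> hom C X A" "k \<cdot> \<pi>1 \<in> hom C X B"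
    using sq hk(2) by (auto simp: hom_def Dom_Obj)
  ultimately have "\<exists>!l. l \<in> hom C X Q \<and> l \<cdot> \<pi>0 = k \<cdot> \<pi>0 \<and> l \<cdot> \<pi>1 = k \<cdot> \<pi>1"
    using pb unfolding is_pullback_def by blast
  then show ?thesis
    using hk by blast
qed

end


context cartesian_category
begin

lemma proj_typing [simp]:
  assumes "A \<in> Obj C" "B \<in> Obj C"
  shows "Prod P A B \<in> Obj C"
    "Pr0 P A B \<in> Arr C" "Dom C (Pr0 P A B) = Prod P A B" "Cod C (Pr0 P A B) = A"
    "Pr1 P A B \<in> Arr C" "Dom C (Pr1 P A B) = Prod P A B" "Cod C (Pr1 P A B) = B"
  using Prod_Obj[OF assms] Pr0_hom[OF assms] Pr1_hom[OF assms] by (auto simp: hom_def)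

lemma bang_typing [simp]:
  assumes "X \<in> Obj C"
  shows "bang C P X \<in> Arr C" "Dom C (bang C P X) = X" "Cod C (bang C P X) = Term P"
  using theI'[OF Term_univ[OF assms]] by (auto simp: bang_def hom_def)

lemma into_Term_unique:
  assumes "f \<in> hom C X (Term P)" "g \<in> hom C X (Term P)"
  shows "f = g"
  using Term_univ[of X] assms by (auto simp: hom_def Dom_Obj)

lemma comp_bang [simp]:
  assumes "s \<in> Arr C" "Cod C s = X"
  shows "s \<cdot> bang C P X = bang C P (Dom C s)"
  using assms by (intro into_Term_unique[of _ "Dom C s"]) (auto simp: hom_def Dom_Obj Cod_Obj)

lemma comp_bang_assoc [simp]:
  assumes "s \<in> Arr C" "Cod C s = X" "k \<in> Arr C" "Dom C k = Term P"
  shows "s \<cdot> (bang C P X \<cdot> k) = bang C P (Dom C s) \<cdot> k"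
proof -
  have "X \<in> Obj C"
    using assms Cod_Obj by blast
  then have "s \<cdot> (bang C P X \<cdot> k) = (s \<cdot> bang C P X) \<cdot> k"
    using assms by (subst comp_assoc) auto
  then show ?thesis
    using assms by simp
qed

lemma pair_universal:
  assumes "f \<in> Arr C" "g \<in> Arr C" "Dom C f = Dom C g"
  shows "pair C P f g \<in> hom C (Dom C f) (Prod P (Cod C f) (Cod C g)) \<and>
    pair C P f g \<cdot> Pr0 P (Cod C f) (Cod C g) = f \<and> pair C P f g \<cdot> Pr1 P (Cod C f) (Cod C g) = g"
  unfolding pair_def induced_def
  by (rule theI'[OF Prod_univ]) (use assms in \<open>auto simp: hom_def\<close>)

lemma pair_typing [simp]:
  assumes "f \<in> Arr C" "g \<in> Arr C" "Dom C f = Dom C g"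
  shows "pair C P f g \<in> Arr C" "Dom C (pair C P f g) = Dom C g"
    "Cod C (pair C P f g) = Prod P (Cod C f) (Cod C g)"
  using pair_universal[OF assms] assms by (auto simp: hom_def)

lemma pair_proj [simp]:
  assumes "f \<in> Arr C" "g \<in> Arr C" "Dom C f = Dom C g" "Cod C f = A" "Cod C g = B"
  shows "pair C P f g \<cdot> Pr0 P A B = f" "pair C P f g \<cdot> Pr1 P A B = g"
  using pair_universal[OF assms(1-3)] assms by auto

lemma pair_proj_assoc [simp]:
  assumes "f \<in> Arr C" "g \<in> Arr C" "Dom C f = Dom C g" "Cod C f = A" "Cod C g = B" "k \<in> Arr C"
  shows "Dom C k = A \<Longrightarrow> pair C P f g \<cdot> (Pr0 P A B \<cdot> k) = f \<cdot> k"
    "Dom C k = B \<Longrightarrow> pair C P f g \<cdot> (Pr1 P A B \<cdot> k) = g \<cdot> k"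
proof -
  have obj: "A \<in> Obj C" "B \<in> Obj C"
    using assms by (auto simp: Cod_Obj)
  show "pair C P f g \<cdot> (Pr0 P A B \<cdot> k) = f \<cdot> k" if "Dom C k = A"
  proof -
    have "pair C P f g \<cdot> (Pr0 P A B \<cdot> k) = (pair C P f g \<cdot> Pr0 P A B) \<cdot> k"
      using assms that obj by (subst comp_assoc) auto
    then show ?thesis
      using assms by simp
  qed
  show "pair C P f g \<cdot> (Pr1 P A B \<cdot> k) = g \<cdot> k" if "Dom C k = B"
  proof -
    have "pair C P f g \<cdot> (Pr1 P A B \<cdot> k) = (pair C P f g \<cdot> Pr1 P A B) \<cdot> k"
      using assms that obj by (subst comp_assoc) auto
    then show ?thesis
      using assms by simp
  qed
qed

lemma pair_eqI:
  assumes "h \<in> hom C X (Prod P A B)" "A \<in> Obj C" "B \<in> Obj C"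
    and "h \<cdot> Pr0 P A B = f" "h \<cdot> Pr1 P A B = g"
  shows "h = pair C P f g"
proof -
  have fg: "f \<in> hom C X A" "g \<in> hom C X B"
    using assms by (auto simp: hom_def)
  then have "pair C P f g \<in> hom C X (Prod P A B) \<and>
      pair C P f g \<cdot> Pr0 P A B = f \<and> pair C P f g \<cdot> Pr1 P A B = g"
    by (simp add: hom_def)
  then show ?thesis
    using Prod_univ[OF fg] assms by blast
qed

lemma comp_pair [simp]:
  assumes "s \<in> Arr C" "f \<in> Arr C" "g \<in> Arr C" "Dom C f = Cod C s" "Dom C g = Cod C s"
  shows "s \<cdot> pair C P f g = pair C P (s \<cdot> f) (s \<cdot> g)"
  using assms
  by (intro pair_eqI[of _ "Dom C s" "Cod C f" "Cod C g"]) (simp_all add: hom_def Cod_Obj)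

end


section \<open>Generalized elements of a group object\<close>

context group_object
begin

lemma structure_typing [simp]:
  "G \<in> Obj C" "Term P \<in> Obj C"
  "m \<in> Arr C" "Dom C m = Prod P G G" "Cod C m = G"
  "u \<in> Arr C" "Dom C u = Term P" "Cod C u = G"
  "\<iota> \<in> Arr C" "Dom C \<iota> = G" "Cod C \<iota> = G"
  using G_Obj Term_Obj m_hom u_hom inv_hom by (auto simp: hom_def)

definition gmul :: "'a \<Rightarrow> 'a \<Rightarrow> 'a" (infixl "\<bullet>" 75) where
  "x \<bullet> y = pair C P x y \<cdot> m"

lemma gmul_hom:
  assumes "x \<in> hom C X G" "y \<in> hom C X G"
  shows "x \<bullet> y \<in> hom C X G"
  using assms by (simp add: gmul_def hom_def)

lemma gmul_assoc:
  assumes "x \<in> hom C X G" "y \<in> hom C X G" "z \<in> hom C X G"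
  shows "x \<bullet> y \<bullet> z = x \<bullet> (y \<bullet> z)"
proof -
  let ?w = "pair C P (pair C P x y) z"
  let ?l = "cross C P m (Ident C G) \<cdot> m"
  have "?w \<cdot> ?l = (?w \<cdot> cross C P m (Ident C G)) \<cdot> m"
    using assms by (subst comp_assoc) (simp_all add: hom_def cross_def)
  also have "\<dots> = x \<bullet> y \<bullet> z"
    using assms by (simp add: hom_def cross_def gmul_def)
  finally have l: "?w \<cdot> ?l = x \<bullet> y \<bullet> z" .
  let ?a = "pair C P (Pr0 P (Prod P G G) G \<cdot> Pr0 P G G)
    (pair C P (Pr0 P (Prod P G G) G \<cdot> Pr1 P G G) (Pr1 P (Prod P G G) G))"
  have "?w \<cdot> (?a \<cdot> cross C P (Ident C G) m \<cdot> m) = ((?w \<cdot> ?a) \<cdot> cross C P (Ident C G) m) \<cdot> m"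
    using assms by (simp add: hom_def cross_def del: comp_pair)
  also have "\<dots> = x \<bullet> (y \<bullet> z)"
    using assms by (simp add: hom_def cross_def gmul_def)
  finally show ?thesis
    using l m_assoc by simp
qed

text \<open>The unit and inverse laws hold for the identity of \<open>G\<close>; precomposition transports them to
  every generalized element.\<close>

lemma gmul_right_unit:
  assumes "x \<in> hom C X G"
  shows "x \<bullet> (bang C P X \<cdot> u) = x"
proof -
  have "x \<cdot> (pair C P (Ident C G) (bang C P G \<cdot> u) \<cdot> m) = x"
    using assms m_right_unit by (simp add: hom_def)
  moreover have "x \<cdot> (pair C P (Ident C G) (bang C P G \<cdot> u) \<cdot> m)
      = (x \<cdot> pair C P (Ident C G) (bang C P G \<cdot> u)) \<cdot> m"
    using assms by (subst comp_assoc) (simp_all add: hom_def)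
  ultimately show ?thesis
    using assms by (simp add: hom_def gmul_def)
qed

lemma gmul_left_inverse:
  assumes "x \<in> hom C X G"
  shows "(x \<cdot> \<iota>) \<bullet> x = bang C P X \<cdot> u"
proof -
  have "x \<cdot> (pair C P \<iota> (Ident C G) \<cdot> m) = bang C P X \<cdot> u"
    using assms m_left_inv by (simp add: hom_def)
  moreover have "x \<cdot> (pair C P \<iota> (Ident C G) \<cdot> m) = (x \<cdot> pair C P \<iota> (Ident C G)) \<cdot> m"
    using assms by (subst comp_assoc) (simp_all add: hom_def)
  ultimately show ?thesis
    using assms by (simp add: hom_def gmul_def)
qed

lemma gmul_right_inverse:
  assumes "x \<in> hom C X G"
  shows "x \<bullet> (x \<cdot> \<iota>) = bang C P X \<cdot> u"
proof -
  have "x \<cdot> (pair C P (Ident C G) \<iota> \<cdot> m) = bang C P X \<cdot> u"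
    using assms m_right_inv by (simp add: hom_def)
  moreover have "x \<cdot> (pair C P (Ident C G) \<iota> \<cdot> m) = (x \<cdot> pair C P (Ident C G) \<iota>) \<cdot> m"
    using assms by (subst comp_assoc) (simp_all add: hom_def)
  ultimately show ?thesis
    using assms by (simp add: hom_def gmul_def)
qed

end


section \<open>The tangent functor and finite products\<close>

context tangent_category
begin

lemma T_typing [simp]:
  "A \<in> Obj C \<Longrightarrow> ob T A \<in> Obj C"
  "f \<in> Arr C \<Longrightarrow> ar T f \<in> Arr C"
  "f \<in> Arr C \<Longrightarrow> Dom C (ar T f) = ob T (Dom C f)"
  "f \<in> Arr C \<Longrightarrow> Cod C (ar T f) = ob T (Cod C f)"
  using T_functor by (auto simp: is_endofunctor_def hom_def)

lemma T_ident: "A \<in> Obj C \<Longrightarrow> ar T (Ident C A) = Ident C (ob T A)"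
  using T_functor by (auto simp: is_endofunctor_def)

lemma T_comp:
  assumes "f \<in> Arr C" "g \<in> Arr C" "Cod C f = Dom C g"
  shows "ar T (f \<cdot> g) = ar T f \<cdot> ar T g"
  using T_functor assms by (auto simp: is_endofunctor_def hom_def)

lemma p_zero_typing [simp]:
  assumes "A \<in> Obj C"
  shows "tp T A \<in> Arr C" "Dom C (tp T A) = ob T A" "Cod C (tp T A) = A"
    "tzero T A \<in> Arr C" "Dom C (tzero T A) = A" "Cod C (tzero T A) = ob T A"
  using p_natural zero_natural assms by (auto simp: is_natural_def id_functor_def hom_def)

lemma p_nat: "f \<in> Arr C \<Longrightarrow> ar T f \<cdot> tp T (Cod C f) = tp T (Dom C f) \<cdot> f"
  using p_natural by (auto simp: is_natural_def id_functor_def hom_def)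

lemma zero_nat: "f \<in> Arr C \<Longrightarrow> tzero T (Dom C f) \<cdot> ar T f = f \<cdot> tzero T (Cod C f)"
  using zero_natural by (auto simp: is_natural_def id_functor_def hom_def)

lemma zero_p: "A \<in> Obj C \<Longrightarrow> tzero T A \<cdot> tp T A = Ident C A"
  using tangent_additive[of A] by (simp add: additive_bundle_def tangent_bundle_def)

end


context cartesian_tangent_category
begin

text \<open>The comparison isomorphism says that \<open>T(A \<times> B)\<close>, with projections \<open>T(\<pi>\<^sub>0)\<close> and
  \<open>T(\<pi>\<^sub>1)\<close>, is a product of \<open>T(A)\<close> and \<open>T(B)\<close>.  In this form elements of
  \<open>T(A) \<times> T(B)\<close> can be handled by naturality alone, without the comparison map.\<close>

lemma T_Prod_lift:
  assumes x: "x \<in> hom C X (ob T A)" and y: "y \<in> hom C X (ob T B)"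
    and obj: "A \<in> Obj C" "B \<in> Obj C"
  obtains w where "w \<in> hom C X (ob T (Prod P A B))"
    "w \<cdot> ar T (Pr0 P A B) = x" "w \<cdot> ar T (Pr1 P A B) = y"
proof -
  let ?\<kappa> = "comparison C P T A B"
  obtain j where j: "j \<in> hom C (Prod P (ob T A) (ob T B)) (ob T (Prod P A B))"
    "j \<cdot> ?\<kappa> = Ident C (Prod P (ob T A) (ob T B))"
    using comparison_Prod[OF obj] by (auto simp: iso_arrow_def inverse_arrows_def)
  define w where "w = pair C P x y \<cdot> j"
  have w: "w \<in> hom C X (ob T (Prod P A B))"
    unfolding w_def using x y j(1) by (simp add: hom_def)
  have "w \<cdot> ?\<kappa> = pair C P x y \<cdot> (j \<cdot> ?\<kappa>)"
    unfolding w_def using x y j(1) obj by (intro comp_assoc) (auto simp: hom_def comparison_def)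
  also have "\<dots> = pair C P x y"
    unfolding j(2) using x y obj by (simp add: hom_def)
  finally have eq: "pair C P (w \<cdot> ar T (Pr0 P A B)) (w \<cdot> ar T (Pr1 P A B)) = pair C P x y"
    unfolding comparison_def using w obj by (simp add: hom_def)
  have "w \<cdot> ar T (Pr0 P A B) = pair C P x y \<cdot> Pr0 P (ob T A) (ob T B)"
    "w \<cdot> ar T (Pr1 P A B) = pair C P x y \<cdot> Pr1 P (ob T A) (ob T B)"
    unfolding eq[symmetric] using w obj by (simp_all add: hom_def)
  then show thesis
    using w x y by (intro that[of w]) (simp_all add: hom_def)
qed

lemma into_T_Term_unique:
  assumes "f \<in> hom C X (ob T (Term P))" "g \<in> hom C X (ob T (Term P))"
  shows "f = g"
proof -
  let ?b = "bang C P (ob T (Term P))"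
  have inv: "inverse_arrow C ?b \<in> hom C (Term P) (ob T (Term P))"
    "?b \<cdot> inverse_arrow C ?b = Ident C (ob T (Term P))"
    using inverse_arrow_inverse[OF comparison_Term] by (auto simp: inverse_arrows_def)
  have retract: "h = (h \<cdot> ?b) \<cdot> inverse_arrow C ?b" if "h \<in> hom C X (ob T (Term P))" for h
  proof -
    have "(h \<cdot> ?b) \<cdot> inverse_arrow C ?b = h \<cdot> (?b \<cdot> inverse_arrow C ?b)"
      using that inv(1) by (intro comp_assoc) (auto simp: hom_def Term_Obj)
    then show ?thesis
      using that by (simp add: inv(2) hom_def)
  qed
  have "f \<cdot> ?b = g \<cdot> ?b"
    using assms by (simp add: hom_def)
  then show ?thesis
    using retract[OF assms(1)] retract[OF assms(2)] by simp
qed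

end


section \<open>The tangent bundle of a group object\<close>

locale tangent_group = cartesian_tangent_category C T P + group_object C P G m u \<iota>
  for C :: "('o, 'a, 'z) category_scheme" (structure)
    and T :: "('o, 'a, 'y) tangent_structure_scheme"
    and P :: "('o, 'a, 'x) product_structure_scheme"
    and G :: 'o and m u \<iota> :: 'a
begin

definition tmul :: "'a \<Rightarrow> 'a \<Rightarrow> 'a" (infixl "\<star>" 75) where
  "x \<star> y = pair C P x y \<cdot> tangent_mult C T P G m"

lemma tangent_mult_typing [simp]:
  "tangent_mult C T P G m \<in> Arr C"
  "Dom C (tangent_mult C T P G m) = Prod P (ob T G) (ob T G)"
  "Cod C (tangent_mult C T P G m) = ob T G"
  using inverse_arrow_inverse[OF comparison_Prod[OF G_Obj G_Obj]]
  by (auto simp: tangent_mult_def inverse_arrows_def hom_def)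

lemma tmul_hom:
  assumes "x \<in> hom C X (ob T G)" "y \<in> hom C X (ob T G)"
  shows "x \<star> y \<in> hom C X (ob T G)"
  using assms by (simp add: tmul_def hom_def)

lemma comp_tmul:
  assumes "s \<in> hom C Y X" "x \<in> hom C X (ob T G)" "y \<in> hom C X (ob T G)"
  shows "s \<cdot> (x \<star> y) = (s \<cdot> x) \<star> (s \<cdot> y)"
proof -
  have "s \<cdot> (x \<star> y) = (s \<cdot> pair C P x y) \<cdot> tangent_mult C T P G m"
    unfolding tmul_def using assms by (subst comp_assoc) (auto simp: hom_def)
  then show ?thesis
    using assms by (simp add: tmul_def hom_def)
qed

text \<open>Eliminates the inverse of the comparison map that is hidden in \<open>\<star>\<close>: an element of
  \<open>T(G) \<times> T(G)\<close> that is presented by an element of \<open>T(G \<times> G)\<close> is multiplied by applying the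
  functor to \<open>m\<close>.\<close>

lemma tmul_eq:
  assumes w: "w \<in> hom C X (ob T (Prod P G G))"
  shows "(w \<cdot> ar T (Pr0 P G G)) \<star> (w \<cdot> ar T (Pr1 P G G)) = w \<cdot> ar T m"
proof -
  let ?\<kappa> = "comparison C P T G G"
  have \<kappa>: "?\<kappa> \<in> hom C (ob T (Prod P G G)) (Prod P (ob T G) (ob T G))"
    and inv: "inverse_arrow C ?\<kappa> \<in> hom C (Prod P (ob T G) (ob T G)) (ob T (Prod P G G))"
    "?\<kappa> \<cdot> inverse_arrow C ?\<kappa> = Ident C (ob T (Prod P G G))"
    using inverse_arrow_inverse[OF comparison_Prod[OF G_Obj G_Obj]]
    by (auto simp: inverse_arrows_def)
  have "pair C P (w \<cdot> ar T (Pr0 P G G)) (w \<cdot> ar T (Pr1 P G G)) = w \<cdot> ?\<kappa>"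
    unfolding comparison_def by (rule comp_pair[symmetric]) (use w in \<open>auto simp: hom_def\<close>)
  then have "(w \<cdot> ar T (Pr0 P G G)) \<star> (w \<cdot> ar T (Pr1 P G G))
      = (w \<cdot> ?\<kappa>) \<cdot> (inverse_arrow C ?\<kappa> \<cdot> ar T m)"
    by (simp add: tmul_def tangent_mult_def)
  also have "\<dots> = w \<cdot> ((?\<kappa> \<cdot> inverse_arrow C ?\<kappa>) \<cdot> ar T m)"
    using w \<kappa> inv(1) by (simp add: hom_def)
  also have "\<dots> = w \<cdot> ar T m"
    unfolding inv(2) by simp
  finally show ?thesis .
qed

lemma T_gmul:
  assumes a: "a \<in> hom C X G" and b: "b \<in> hom C X G"
  shows "ar T (a \<bullet> b) = ar T a \<star> ar T b"
proof -
  let ?w = "ar T (pair C P a b)"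
  have w: "?w \<in> hom C (ob T X) (ob T (Prod P G G))"
    using a b by (simp add: hom_def)
  have "?w \<cdot> ar T (Pr0 P G G) = ar T a" "?w \<cdot> ar T (Pr1 P G G) = ar T b"
    "?w \<cdot> ar T m = ar T (a \<bullet> b)"
    using a b by (simp_all add: gmul_def hom_def T_comp[symmetric])
  then show ?thesis
    using tmul_eq[OF w] by simp
qed

text \<open>Any three elements of \<open>T(G)\<close> arise from a single element of \<open>T((G \<times> G) \<times> G)\<close> by the images
  of the projections, so it suffices to apply \<open>T\<close> to the associative law for the three projections
  \<open>(G \<times> G) \<times> G \<rightarrow> G\<close>.\<close>

lemma tmul_assoc:
  assumes x: "x \<in> hom C X (ob T G)" and y: "y \<in> hom C X (ob T G)" and z: "z \<in> hom C X (ob T G)"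
  shows "x \<star> y \<star> z = x \<star> (y \<star> z)"
proof -
  let ?Q = "Prod P (Prod P G G) G"
  let ?a = "Pr0 P (Prod P G G) G \<cdot> Pr0 P G G"
    and ?b = "Pr0 P (Prod P G G) G \<cdot> Pr1 P G G"
    and ?c = "Pr1 P (Prod P G G) G"
  obtain v where v: "v \<in> hom C X (ob T (Prod P G G))"
    "v \<cdot> ar T (Pr0 P G G) = x" "v \<cdot> ar T (Pr1 P G G) = y"
    using T_Prod_lift[OF x y G_Obj G_Obj] .
  obtain w where w: "w \<in> hom C X (ob T ?Q)"
    "w \<cdot> ar T (Pr0 P (Prod P G G) G) = v" "w \<cdot> ar T ?c = z"
    using T_Prod_lift[OF v(1) z Prod_Obj[OF G_Obj G_Obj] G_Obj] .
  have abc: "?a \<in> hom C ?Q G" "?b \<in> hom C ?Q G" "?c \<in> hom C ?Q G"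
    by (simp_all add: hom_def)
  then have Tabc: "ar T ?a \<in> hom C (ob T ?Q) (ob T G)" "ar T ?b \<in> hom C (ob T ?Q) (ob T G)"
    "ar T ?c \<in> hom C (ob T ?Q) (ob T G)"
    by (simp_all add: hom_def)
  have "w \<cdot> ar T ?a = (w \<cdot> ar T (Pr0 P (Prod P G G) G)) \<cdot> ar T (Pr0 P G G)"
    "w \<cdot> ar T ?b = (w \<cdot> ar T (Pr0 P (Prod P G G) G)) \<cdot> ar T (Pr1 P G G)"
    using w(1) by (simp_all add: T_comp hom_def)
  then have xyz: "x = w \<cdot> ar T ?a" "y = w \<cdot> ar T ?b" "z = w \<cdot> ar T ?c"
    using v w by simp_all
  have "ar T ?a \<star> ar T ?b \<star> ar T ?c = ar T (?a \<bullet> ?b \<bullet> ?c)"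
    by (simp add: T_gmul[OF gmul_hom[OF abc(1,2)] abc(3)] T_gmul[OF abc(1,2)])
  also have "\<dots> = ar T (?a \<bullet> (?b \<bullet> ?c))"
    using gmul_assoc[OF abc] by simp
  also have "\<dots> = ar T ?a \<star> (ar T ?b \<star> ar T ?c)"
    by (simp add: T_gmul[OF abc(1) gmul_hom[OF abc(2,3)]] T_gmul[OF abc(2,3)])
  finally have assoc: "ar T ?a \<star> ar T ?b \<star> ar T ?c = ar T ?a \<star> (ar T ?b \<star> ar T ?c)" .
  have "x \<star> y \<star> z = w \<cdot> (ar T ?a \<star> ar T ?b \<star> ar T ?c)"
    unfolding xyz comp_tmul[OF w(1) tmul_hom[OF Tabc(1,2)] Tabc(3)] comp_tmul[OF w(1) Tabc(1,2)] ..
  also have "\<dots> = x \<star> (y \<star> z)"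
    unfolding xyz assoc
      comp_tmul[OF w(1) Tabc(1) tmul_hom[OF Tabc(2,3)]] comp_tmul[OF w(1) Tabc(2,3)] ..
  finally show ?thesis .
qed

text \<open>Naturality of \<open>0\<close> at \<open>m\<close>: the two zero vectors are the components of the zero vector at
  the point \<open>(a, b)\<close> of \<open>G \<times> G\<close>.\<close>

lemma tmul_zero:
  assumes a: "a \<in> hom C X G" and b: "b \<in> hom C X G"
  shows "(a \<cdot> tzero T G) \<star> (b \<cdot> tzero T G) = (a \<bullet> b) \<cdot> tzero T G"
proof -
  let ?w = "pair C P a b \<cdot> tzero T (Prod P G G)"
  have w: "?w \<in> hom C X (ob T (Prod P G G))"
    using a b by (simp add: hom_def)
  have eqs: "?w \<cdot> ar T (Pr0 P G G) = a \<cdot> tzero T G"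
    "?w \<cdot> ar T (Pr1 P G G) = b \<cdot> tzero T G"
    "?w \<cdot> ar T m = (a \<bullet> b) \<cdot> tzero T G"
    using a b zero_nat[of "Pr0 P G G"] zero_nat[of "Pr1 P G G"] zero_nat[of m]
    by (simp_all add: gmul_def hom_def)
  show ?thesis
    using tmul_eq[OF w] unfolding eqs .
qed

text \<open>Naturality of \<open>p\<close> at \<open>m\<close>, applied to the element of \<open>T(G \<times> G)\<close> with components \<open>x\<close>
  and \<open>y\<close>.\<close>

lemma tmul_p:
  assumes x: "x \<in> hom C X (ob T G)" and y: "y \<in> hom C X (ob T G)"
  shows "(x \<star> y) \<cdot> tp T G = (x \<cdot> tp T G) \<bullet> (y \<cdot> tp T G)"
proof -
  obtain w where w: "w \<in> hom C X (ob T (Prod P G G))"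
    "w \<cdot> ar T (Pr0 P G G) = x" "w \<cdot> ar T (Pr1 P G G) = y"
    using T_Prod_lift[OF x y G_Obj G_Obj] .
  have "w \<cdot> tp T (Prod P G G) = pair C P (x \<cdot> tp T G) (y \<cdot> tp T G)"
  proof (rule pair_eqI)
    show "w \<cdot> tp T (Prod P G G) \<in> hom C X (Prod P G G)"
      using w(1) by (simp add: hom_def)
    show "(w \<cdot> tp T (Prod P G G)) \<cdot> Pr0 P G G = x \<cdot> tp T G"
      unfolding w(2)[symmetric] using w(1) p_nat[of "Pr0 P G G"] by (simp add: hom_def)
    show "(w \<cdot> tp T (Prod P G G)) \<cdot> Pr1 P G G = y \<cdot> tp T G"
      unfolding w(3)[symmetric] using w(1) p_nat[of "Pr1 P G G"] by (simp add: hom_def)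
  qed simp_all
  moreover have "(x \<star> y) \<cdot> tp T G = (w \<cdot> tp T (Prod P G G)) \<cdot> m"
    using tmul_eq[OF w(1)] w p_nat[of m] by (simp add: hom_def)
  ultimately show ?thesis
    by (simp add: gmul_def)
qed

text \<open>Applying \<open>T\<close> to the unit law produces the unit \<open>T(!) T(u)\<close>.  It is the zero vector at \<open>u\<close>
  because \<open>T(1)\<close> is terminal, so that every arrow \<open>X \<rightarrow> T(1)\<close> factors through \<open>0\<close>.\<close>

lemma tmul_left_unit:
  assumes x: "x \<in> hom C X (ob T G)"
  shows "(bang C P X \<cdot> (u \<cdot> tzero T G)) \<star> x = x"
proof -
  have X: "X \<in> Obj C"
    using x by (auto simp: hom_def Dom_Obj)
  have "bang C P G \<cdot> u \<in> hom C G G" "Ident C G \<in> hom C G G"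
    by (simp_all add: hom_def)
  from T_gmul[OF this] have unit: "ar T (bang C P G \<cdot> u) \<star> Ident C (ob T G) = Ident C (ob T G)"
    by (simp add: gmul_def m_left_unit T_ident)
  have "x \<cdot> ar T (bang C P G) = bang C P X \<cdot> tzero T (Term P)"
    by (rule into_T_Term_unique[of _ X]) (use x X in \<open>simp_all add: hom_def\<close>)
  then have "(x \<cdot> ar T (bang C P G)) \<cdot> ar T u = (bang C P X \<cdot> tzero T (Term P)) \<cdot> ar T u"
    by simp
  then have zero: "x \<cdot> ar T (bang C P G \<cdot> u) = bang C P X \<cdot> (u \<cdot> tzero T G)"
    using x X zero_nat[of u] by (simp add: hom_def T_comp)
  have "x = x \<cdot> (ar T (bang C P G \<cdot> u) \<star> Ident C (ob T G))"
    using x by (simp add: unit hom_def)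
  also have "\<dots> = (x \<cdot> ar T (bang C P G \<cdot> u)) \<star> (x \<cdot> Ident C (ob T G))"
    by (rule comp_tmul) (use x in \<open>simp_all add: hom_def\<close>)
  finally show ?thesis
    using x by (simp add: zero hom_def)
qed

text \<open>Left translations by zero vectors at mutually inverse points undo each other; both
  composites of the trivialization with its inverse reduce to this.\<close>

lemma tmul_zero_cancel:
  assumes a: "a \<in> hom C X G" and b: "b \<in> hom C X G" and x: "x \<in> hom C X (ob T G)"
    and inverse: "a \<bullet> b = bang C P X \<cdot> u"
  shows "(a \<cdot> tzero T G) \<star> ((b \<cdot> tzero T G) \<star> x) = x"
proof -
  have X: "X \<in> Obj C"
    using x by (auto simp: hom_def Dom_Obj)
  have "(a \<cdot> tzero T G) \<star> ((b \<cdot> tzero T G) \<star> x) = ((a \<cdot> tzero T G) \<star> (b \<cdot> tzero T G)) \<star> x"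
    by (rule tmul_assoc[symmetric]) (use a b x in \<open>simp_all add: hom_def\<close>)
  also have "\<dots> = (bang C P X \<cdot> (u \<cdot> tzero T G)) \<star> x"
    using X by (simp add: tmul_zero[OF a b] inverse)
  finally show ?thesis
    using tmul_left_unit[OF x] by simp
qed

text \<open>The arrow \<open>\<langle>p \<iota> 0, 1\<rangle> T(m)\<close>, which translates each tangent vector to the unit.\<close>

definition to_unit :: 'a where
  "to_unit = (tp T G \<cdot> \<iota> \<cdot> tzero T G) \<star> Ident C (ob T G)"

lemma to_unit_hom: "to_unit \<in> hom C (ob T G) (ob T G)"
  unfolding to_unit_def by (rule tmul_hom) (simp_all add: hom_def)

lemma comp_to_unit:
  assumes x: "x \<in> hom C X (ob T G)"
  shows "x \<cdot> to_unit = (x \<cdot> tp T G \<cdot> \<iota> \<cdot> tzero T G) \<star> x"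
proof -
  have "x \<cdot> to_unit = (x \<cdot> (tp T G \<cdot> \<iota> \<cdot> tzero T G)) \<star> (x \<cdot> Ident C (ob T G))"
    unfolding to_unit_def by (rule comp_tmul) (use x in \<open>simp_all add: hom_def\<close>)
  then show ?thesis
    using x by (simp add: hom_def)
qed

lemma to_unit_p: "to_unit \<cdot> tp T G = bang C P (ob T G) \<cdot> u"
proof -
  have "to_unit \<cdot> tp T G = (tp T G \<cdot> \<iota> \<cdot> tzero T G \<cdot> tp T G) \<bullet> (Ident C (ob T G) \<cdot> tp T G)"
    unfolding to_unit_def by (rule tmul_p) (simp_all add: hom_def)
  also have "\<dots> = (tp T G \<cdot> \<iota>) \<bullet> tp T G"
    by (simp add: zero_p)
  also have "\<dots> = bang C P (ob T G) \<cdot> u"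
    by (rule gmul_left_inverse) (simp add: hom_def)
  finally show ?thesis .
qed

text \<open>A point \<open>g\<close> and a vector \<open>v\<close> over \<open>u\<close> are recovered from \<open>0(g) \<star> v\<close> because its base
  point is \<open>g \<bullet> u = g\<close>, so that \<open>to_unit\<close> multiplies it by the zero vector at exactly \<open>g\<inverse>\<close>.  The
  fibre component is compared after \<open>pu\<close>; its other component lies in the terminal object.\<close>

theorem left_trivialization:
  assumes pb: "is_pullback C (Term P) (ob T G) G u (tp T G) TGu (bang C P TGu) pu"
  shows "inverse_arrows C (ob T G) (Prod P G TGu)
    (pair C P (tp T G) (induced C TGu (bang C P TGu) pu (bang C P (ob T G)) to_unit))
    ((Pr0 P G TGu \<cdot> tzero T G) \<star> (Pr1 P G TGu \<cdot> pu))"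
proof -
  let ?k = "induced C TGu (bang C P TGu) pu (bang C P (ob T G)) to_unit"
  let ?\<phi> = "pair C P (tp T G) ?k"
  let ?g = "Pr0 P G TGu" and ?v = "Pr1 P G TGu"
  let ?\<psi> = "(?g \<cdot> tzero T G) \<star> (?v \<cdot> pu)"
  have fibre [simp]: "TGu \<in> Obj C" "pu \<in> Arr C" "Dom C pu = TGu" "Cod C pu = ob T G"
    and fibre_p: "bang C P TGu \<cdot> u = pu \<cdot> tp T G"
    using pb by (auto simp: is_pullback_def hom_def)
  have k: "?k \<in> hom C (ob T G) TGu" "?k \<cdot> pu = to_unit"
    using pullback_induced[OF pb _ to_unit_hom] to_unit_p by (simp_all add: hom_def)
  then have \<phi>: "?\<phi> \<in> hom C (ob T G) (Prod P G TGu)"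
    by (simp add: hom_def)
  have factors: "?g \<cdot> tzero T G \<in> hom C (Prod P G TGu) (ob T G)"
    "?v \<cdot> pu \<in> hom C (Prod P G TGu) (ob T G)"
    by (simp_all add: hom_def)
  then have \<psi>: "?\<psi> \<in> hom C (Prod P G TGu) (ob T G)"
    by (rule tmul_hom)
  \<comment> \<open>Translating to the unit and back: the inverse law is used in the order \<open>g \<bullet> g\<inverse>\<close>.\<close>
  have "?\<phi> \<cdot> ?\<psi> = (?\<phi> \<cdot> (?g \<cdot> tzero T G)) \<star> (?\<phi> \<cdot> (?v \<cdot> pu))"
    by (rule comp_tmul[OF \<phi> factors])
  also have "\<dots> = (tp T G \<cdot> tzero T G) \<star> ((tp T G \<cdot> \<iota> \<cdot> tzero T G) \<star> Ident C (ob T G))"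
    using k by (simp add: hom_def to_unit_def)
  also have "\<dots> = Ident C (ob T G)"
    by (rule tmul_zero_cancel[OF _ _ _ gmul_right_inverse]) (simp_all add: hom_def)
  finally have \<phi>\<psi>: "?\<phi> \<cdot> ?\<psi> = Ident C (ob T G)" .
  have "?\<psi> \<cdot> tp T G = (?g \<cdot> tzero T G \<cdot> tp T G) \<bullet> (?v \<cdot> pu \<cdot> tp T G)"
    by (rule tmul_p[OF factors])
  also have "\<dots> = ?g \<bullet> (bang C P (Prod P G TGu) \<cdot> u)"
    by (simp add: zero_p fibre_p[symmetric])
  also have "\<dots> = ?g"
    by (rule gmul_right_unit) (simp add: hom_def)
  finally have \<psi>_p: "?\<psi> \<cdot> tp T G = ?g" .
  have "?\<psi> \<cdot> to_unit = (?\<psi> \<cdot> tp T G \<cdot> \<iota> \<cdot> tzero T G) \<star> ?\<psi>"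
    by (rule comp_to_unit[OF \<psi>])
  also have "\<dots> = ?v \<cdot> pu"
    unfolding \<psi>_p
    by (rule tmul_zero_cancel[OF _ _ _ gmul_left_inverse]) (simp_all add: hom_def)
  finally have \<psi>_to_unit: "?\<psi> \<cdot> to_unit = ?v \<cdot> pu" .
  have \<psi>_k: "?\<psi> \<cdot> ?k = ?v"
  proof (rule pullback_cancel[OF pb])
    show "?\<psi> \<cdot> ?k \<in> hom C (Prod P G TGu) TGu" "?v \<in> hom C (Prod P G TGu) TGu"
      using \<psi> k(1) by (simp_all add: hom_def)
    show "(?\<psi> \<cdot> ?k) \<cdot> bang C P TGu = ?v \<cdot> bang C P TGu"
      using \<psi> k(1) by (simp add: hom_def)
    show "(?\<psi> \<cdot> ?k) \<cdot> pu = ?v \<cdot> pu"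
      using \<psi> k \<psi>_to_unit by (simp add: hom_def)
  qed
  have "?\<psi> \<cdot> ?\<phi> = pair C P ?g ?v"
    using \<psi> k(1) \<psi>_p \<psi>_k by (simp add: hom_def)
  also have "\<dots> = Ident C (Prod P G TGu)"
    by (rule pair_eqI[of _ _ G TGu, symmetric]) (simp_all add: hom_def)
  finally show ?thesis
    using \<phi> \<psi> \<phi>\<psi> by (simp add: inverse_arrows_def)
qed

end


section \<open>The trivialization of the tangent bundle\<close>

theorem theorem1:
  fixes C :: "('o, 'a) category" (structure)
    and T :: "('o, 'a) tangent_structure"
    and P :: "('o, 'a) product_structure"
    and G TGu :: 'o
    and m u \<iota> pu :: 'a
  assumes "cartesian_tangent_category C T P"
    and "group_object C P G m u \<iota>"
    and "is_pullback C (Term P) (ob T G) G u (tp T G) TGu (bang C P TGu) pu"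
  shows "let Tm = tangent_mult C T P G m;
             h = pair C P (tp T G \<cdot> \<iota> \<cdot> tzero T G) (Ident C (ob T G)) \<cdot> Tm;
             \<phi> = pair C P (tp T G)
                   (induced C TGu (bang C P TGu) pu (bang C P (ob T G)) h);
             \<psi> = cross C P (tzero T G) pu \<cdot> Tm
         in isomorphic C (ob T G) (Prod P G TGu) \<and>
            h \<cdot> tp T G = bang C P (ob T G) \<cdot> u \<and>
            inverse_arrows C (ob T G) (Prod P G TGu) \<phi> \<psi>"
proof -
  interpret tangent_group C T P G m u \<iota>
    using assms(1,2) by (rule tangent_group.intro)
  have "TGu \<in> Obj C" "pu \<in> hom C TGu (ob T G)"
    using assms(3) by (auto simp: is_pullback_def)
  then have \<psi>: "cross C P (tzero T G) pu \<cdot> tangent_mult C T P G m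
      = (Pr0 P G TGu \<cdot> tzero T G) \<star> (Pr1 P G TGu \<cdot> pu)"
    by (simp add: cross_def tmul_def hom_def)
  show ?thesis
    using left_trivialization[OF assms(3)] to_unit_p
    unfolding Let_def \<psi> to_unit_def tmul_def isomorphic_def iso_arrow_def by blast
qed

end
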